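(* Let $f:\mathbb{R}\to\mathbb{R}$ be defined by $f(t)=e^{-1/t}$ for $t>0$ and $f(t)=0$ for $t\le 0$. For every $i\in\mathbb{N}$, $$f^{(i)}(t)=\begin{cases}\displaystyle\frac{1}{e^{1/t}t^{2i}}\sum_{k=0}^{i-1}(-1)^k a_{i,k}t^{k}, & t>0,\\[1ex] 0, & t\le 0,\end{cases}$$ where $$a_{i,k}=\binom{i}{k}\binom{i-1}{k}k!$$ for all $0\le k\le i-1$.
   Context: $\mathbb{N}$ denotes the set of positive integers, and $f^{(i)}$ denotes the $i$-th derivative of $f$. *)

theory Defs
  imports "HOL-Analysis.Analysis"
begin

definition flat_exp :: "real \<Rightarrow> real" where
  "flat_exp t = (if t > 0 then exp (- 1 / t) else 0)"

definition deriv_coeff :: "nat \<Rightarrow> nat \<Rightarrow> nat" where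
  "deriv_coeff i k = (i choose k) * ((i - 1) choose k) * fact k"

text \<open>
  The library function \<^const>\<open>deriv\<close> is total, with an unspecified value at points where its
  argument is not differentiable.  An equation for an iterated derivative therefore has to be
  accompanied by differentiability of the derivatives of lower order.
\<close>

definition times_differentiable :: "nat \<Rightarrow> (real \<Rightarrow> real) \<Rightarrow> bool" where
  "times_differentiable n g \<longleftrightarrow> (\<forall>j<n. \<forall>x. (deriv ^^ j) g differentiable (at x))"

end

theory Submission
  imports Defs
begin

text \<open>
  Write \<open>a\<close> for \<^const>\<open>deriv_coeff\<close> and put \<open>P\<^sub>i(t) = (\<Sum>k\<le>i. (-1)^k * a i k * t^k)\<close>.
  The claim is that the \<open>i\<close>-th derivative of \<^const>\<open>flat_exp\<close> is the function \<open>F\<^sub>i\<close> that equals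
  \<open>exp (-1/t) * P\<^sub>i(t) / t^(2*i)\<close> for \<open>t > 0\<close> and vanishes for \<open>t \<le> 0\<close>.
  This also holds for \<open>i = 0\<close>, because \<open>P\<^sub>0 = 1\<close>, so one may argue by induction from \<open>i = 0\<close>;
  what has to be shown is that \<open>F\<^sub>i\<close> has derivative \<open>F\<^sub>i\<^sub>+\<^sub>1\<close> everywhere
  (\<open>flat_exp_deriv_has_derivative\<close>).

  For \<open>t > 0\<close> the product rule reduces this to
  \<open>P\<^sub>i\<^sub>+\<^sub>1(t) = P\<^sub>i(t) - 2*i*t*P\<^sub>i(t) + t^2*P\<^sub>i'(t)\<close>, which on coefficients is the recurrence
  \<open>a (i+1) (j+1) = a i (j+1) + (2*i - j) * a i j\<close>.  By the absorption identities for binomial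
  coefficients, \<open>(j+1) * a i (j+1) = (i-j)*(i-1-j) * a i j\<close> and
  \<open>(j+1) * a (i+1) (j+1) = (i+1)*i * a i j\<close>, so the recurrence comes down to
  \<open>(i+1)*i = (i-j)*(i-1-j) + (j+1)*(2*i-j)\<close>.
  For \<open>t < 0\<close> there is nothing to do, and at \<open>0\<close> the right-hand difference quotient
  \<open>exp (-1/t) / t^(2*i+1) * P\<^sub>i(t)\<close> tends to \<open>0\<close> since the exponential beats every power.
\<close>

section \<open>The coefficients\<close>

lemma deriv_coeff_0 [simp]: "deriv_coeff i 0 = 1"
  by (simp add: deriv_coeff_def)

lemma deriv_coeff_eq_0: "k \<ge> i \<Longrightarrow> k > 0 \<Longrightarrow> deriv_coeff i k = 0"
  by (cases i) (auto simp: deriv_coeff_def)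

lemma binomial_absorb_real:
  "real (Suc j) * real (n choose Suc j) = (real n - real j) * real (n choose j)"
proof (cases "j \<le> n")
  case True
  have "Suc j * (n choose Suc j) = (n - j) * (n choose j)"
    by (simp only: binomial_absorption binomial_absorb_comp)
  then show ?thesis
    using True by (metis of_nat_diff of_nat_mult)
qed (simp add: binomial_eq_0)

text \<open>
  The case \<open>i = 0\<close> is included although \<open>deriv_coeff 0 0 = 1\<close>, by truncated subtraction:
  for \<open>j = 0\<close> the factor \<open>i - j\<close> is zero.
\<close>

lemma deriv_coeff_Suc_right:
  "real (Suc j) * real (deriv_coeff i (Suc j)) =
     (real i - real j) * (real i - 1 - real j) * real (deriv_coeff i j)"
proof (cases i)
  case 0
  then show ?thesis
    by (cases j) (simp_all add: deriv_coeff_eq_0)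
next
  case (Suc m)
  have "real (Suc j) * real (deriv_coeff i (Suc j)) =
      (real (Suc j) * real (i choose Suc j)) * (real (Suc j) * real (m choose Suc j)) * fact j"
    by (simp add: deriv_coeff_def Suc algebra_simps del: binomial_Suc_Suc)
  also have "\<dots> = (real i - real j) * (real m - real j) * real (deriv_coeff i j)"
    unfolding binomial_absorb_real by (simp add: deriv_coeff_def Suc)
  finally show ?thesis
    by (simp add: Suc)
qed

lemma deriv_coeff_Suc_Suc:
  "real (Suc j) * real (deriv_coeff (Suc i) (Suc j)) =
     real (Suc i) * real i * real (deriv_coeff i j)"
proof (cases i)
  case 0
  then show ?thesis
    by (simp add: deriv_coeff_eq_0)
next
  case (Suc m)
  have absorb: "real (Suc j) * real (Suc n choose Suc j) = real (Suc n) * real (n choose j)" for n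
    by (metis Suc_times_binomial of_nat_mult)
  have "real (Suc j) * real (deriv_coeff (Suc i) (Suc j)) =
      (real (Suc j) * real (Suc i choose Suc j)) * (real (Suc j) * real (Suc m choose Suc j)) * fact j"
    by (simp add: deriv_coeff_def Suc algebra_simps del: binomial_Suc_Suc)
  also have "\<dots> = real (Suc i) * real i * real (deriv_coeff i j)"
    unfolding absorb by (simp add: deriv_coeff_def Suc)
  finally show ?thesis .
qed

lemma deriv_coeff_recurrence:
  "real (deriv_coeff (Suc i) (Suc j)) =
     real (deriv_coeff i (Suc j)) + (2 * real i - real j) * real (deriv_coeff i j)"
proof -
  have "real (Suc j) * real (deriv_coeff (Suc i) (Suc j)) =
    real (Suc j) * (real (deriv_coeff i (Suc j)) + (2 * real i - real j) * real (deriv_coeff i j))"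
    unfolding distrib_left deriv_coeff_Suc_Suc deriv_coeff_Suc_right [of j i]
    by (simp add: algebra_simps)
  then show ?thesis by simp
qed

section \<open>The numerator polynomials\<close>

text \<open>
  The sum runs up to \<open>i\<close> rather than \<open>i - 1\<close>: the additional coefficient is zero for \<open>i > 0\<close>, and
  for \<open>i = 0\<close> both ranges give the constant \<open>1\<close>.
\<close>

definition deriv_numer :: "nat \<Rightarrow> real \<Rightarrow> real" where
  "deriv_numer i t = (\<Sum>k\<le>i. (-1) ^ k * real (deriv_coeff i k) * t ^ k)"

text \<open>The derivative of \<^const>\<open>deriv_numer\<close> in its real argument.\<close>

definition deriv_numer' :: "nat \<Rightarrow> real \<Rightarrow> real" where
  "deriv_numer' i t = (\<Sum>k\<le>i. (-1) ^ k * real (deriv_coeff i k) * (real k * t ^ (k - 1)))"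

lemma deriv_numer_altdef:
  "deriv_numer i t = (\<Sum>k = 0..i - 1. (-1) ^ k * real (deriv_coeff i k) * t ^ k)"
proof (cases i)
  case (Suc m)
  then show ?thesis
    by (simp add: deriv_numer_def deriv_coeff_eq_0 atMost_atLeast0)
qed (simp add: deriv_numer_def)

lemma deriv_numer_has_derivative:
  "(deriv_numer i has_real_derivative deriv_numer' i t) (at t within S)"
  unfolding deriv_numer_def [abs_def] deriv_numer'_def
  by (auto intro!: derivative_eq_intros sum.cong)

lemma deriv_numer_Suc:
  "deriv_numer (Suc i) t =
     deriv_numer i t - 2 * real i * t * deriv_numer i t + t\<^sup>2 * deriv_numer' i t"
proof -
  define c where "c k = (-1) ^ k * real (deriv_coeff i k)" for k
  \<comment> \<open>the factor \<open>2 * i - j\<close> of the recurrence is split into the contributions of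
    \<open>2 * i * t * P\<close> and \<open>t\<^sup>2 * P'\<close>\<close>
  have c_Suc: "(-1) ^ Suc j * real (deriv_coeff (Suc i) (Suc j)) =
      c (Suc j) - 2 * real i * c j + real j * c j" for j
    unfolding deriv_coeff_recurrence c_def by (simp add: algebra_simps)
  have "deriv_numer (Suc i) t = 1 + (\<Sum>j\<le>i. (-1) ^ Suc j * real (deriv_coeff (Suc i) (Suc j)) * t ^ Suc j)"
    unfolding deriv_numer_def by (subst sum.atMost_Suc_shift) simp
  also have "\<dots> = 1 + (\<Sum>j\<le>i. c (Suc j) * t ^ Suc j) - (\<Sum>j\<le>i. 2 * real i * c j * t ^ Suc j)
                   + (\<Sum>j\<le>i. real j * c j * t ^ Suc j)"
    unfolding c_Suc by (simp add: algebra_simps sum.distrib sum_subtractf)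
  also have "1 + (\<Sum>j\<le>i. c (Suc j) * t ^ Suc j) = (\<Sum>k\<le>Suc i. c k * t ^ k)"
    by (subst sum.atMost_Suc_shift) (simp add: c_def)
  also have "\<dots> = deriv_numer i t"
    by (simp add: c_def deriv_numer_def deriv_coeff_eq_0)
  also have "(\<Sum>j\<le>i. 2 * real i * c j * t ^ Suc j) = 2 * real i * t * deriv_numer i t"
    unfolding deriv_numer_def c_def sum_distrib_left by (intro sum.cong) auto
  also have "(\<Sum>j\<le>i. real j * c j * t ^ Suc j) = t\<^sup>2 * deriv_numer' i t"
    unfolding deriv_numer'_def sum_distrib_left
  proof (intro sum.cong refl)
    fix j
    show "real j * c j * t ^ Suc j =
        t\<^sup>2 * ((-1) ^ j * real (deriv_coeff i j) * (real j * t ^ (j - 1)))"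
      by (cases j) (simp_all add: c_def power2_eq_square algebra_simps)
  qed
  finally show ?thesis .
qed

section \<open>The iterated derivatives\<close>

text \<open>The function that will turn out to be the \<open>i\<close>-th derivative of \<^const>\<open>flat_exp\<close>, for all \<open>i \<ge> 0\<close>.\<close>

definition flat_exp_deriv :: "nat \<Rightarrow> real \<Rightarrow> real" where
  "flat_exp_deriv i t = (if t > 0 then exp (- 1 / t) / t ^ (2 * i) * deriv_numer i t else 0)"

lemma exp_minus_inverse_div_power_tendsto_0:
  "((\<lambda>t::real. exp (- 1 / t) / t ^ m) \<longlongrightarrow> 0) (at_right 0)"
proof -
  have "((\<lambda>t::real. inverse t ^ m / exp (inverse t)) \<longlongrightarrow> 0) (at_right 0)"
    by (rule filterlim_compose [OF tendsto_power_div_exp_0 filterlim_inverse_at_top_right])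
  then show ?thesis
    by (simp add: exp_minus field_simps)
qed

lemma flat_exp_deriv_has_derivative_pos:
  assumes "t > 0"
  shows "(flat_exp_deriv i has_real_derivative flat_exp_deriv (Suc i) t) (at t)"
proof -
  have "real (2 * i) * t ^ (2 * i - 1) * t = 2 * real i * t ^ (2 * i)"
    by (cases i) simp_all
  then have power: "((\<lambda>t. t ^ (2 * i)) has_real_derivative 2 * real i * t ^ (2 * i) / t) (at t)"
    using assms by (intro DERIV_cong [OF DERIV_pow]) (simp add: field_simps)
  have exp: "((\<lambda>t. exp (- 1 / t)) has_real_derivative exp (- 1 / t) / t\<^sup>2) (at t)"
    using assms by (auto intro!: derivative_eq_intros simp: power2_eq_square)
  have "((\<lambda>t. exp (- 1 / t) / t ^ (2 * i) * deriv_numer i t) has_real_derivative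
      flat_exp_deriv (Suc i) t) (at t)"
    by (rule DERIV_cong [OF DERIV_mult [OF DERIV_divide [OF exp power] deriv_numer_has_derivative]])
      (use assms in \<open>simp_all add: flat_exp_deriv_def deriv_numer_Suc field_simps power2_eq_square\<close>)
  moreover have "\<forall>\<^sub>F x in nhds t. flat_exp_deriv i x = exp (- 1 / x) / x ^ (2 * i) * deriv_numer i x"
    using assms eventually_nhds_in_open [of "{0<..}" t]
    by (auto simp: flat_exp_deriv_def elim!: eventually_mono)
  ultimately show ?thesis
    by (subst DERIV_cong_ev [OF refl _ refl])
qed

lemma flat_exp_deriv_has_derivative_neg:
  assumes "t < 0"
  shows "(flat_exp_deriv i has_real_derivative 0) (at t)"
proof -
  have "\<forall>\<^sub>F x in nhds t. flat_exp_deriv i x = 0"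
    using assms eventually_nhds_in_open [of "{..<0}" t]
    by (auto simp: flat_exp_deriv_def elim!: eventually_mono)
  then show ?thesis
    by (subst DERIV_cong_ev [OF refl _ refl]) auto
qed

lemma flat_exp_deriv_has_derivative_0:
  "(flat_exp_deriv i has_real_derivative 0) (at 0)"
proof -
  have "((\<lambda>t. exp (- 1 / t) / t ^ (2 * i + 1) * deriv_numer i t) \<longlongrightarrow> 0 * deriv_numer i 0) (at_right 0)"
    using DERIV_continuous [OF deriv_numer_has_derivative [where i = i and t = 0 and S = "{0<..}"]]
    by (intro tendsto_mult exp_minus_inverse_div_power_tendsto_0) (simp add: continuous_within)
  moreover have "\<forall>\<^sub>F t in at_right 0.
      exp (- 1 / t) / t ^ (2 * i + 1) * deriv_numer i t = flat_exp_deriv i t / t"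
    by (auto simp: eventually_at_filter flat_exp_deriv_def field_simps)
  ultimately have "((\<lambda>t. flat_exp_deriv i t / t) \<longlongrightarrow> 0) (at_right 0)"
    using Lim_transform_eventually by fastforce
  moreover have "((\<lambda>t. flat_exp_deriv i t / t) \<longlongrightarrow> 0) (at_left 0)"
    by (rule tendsto_eventually) (auto simp: eventually_at_filter flat_exp_deriv_def)
  ultimately have "((\<lambda>t. flat_exp_deriv i t / t) \<longlongrightarrow> 0) (at 0)"
    by (simp add: filterlim_split_at)
  then show ?thesis
    by (simp add: DERIV_def flat_exp_deriv_def)
qed

lemma flat_exp_deriv_has_derivative:
  "(flat_exp_deriv i has_real_derivative flat_exp_deriv (Suc i) t) (at t)"
proof (cases t "0 :: real" rule: linorder_cases)
  case less
  then show ?thesis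
    using flat_exp_deriv_has_derivative_neg by (simp add: flat_exp_deriv_def [of "Suc i"])
next
  case equal
  then show ?thesis
    using flat_exp_deriv_has_derivative_0 by (simp add: flat_exp_deriv_def [of "Suc i"])
next
  case greater
  then show ?thesis by (rule flat_exp_deriv_has_derivative_pos)
qed

lemma deriv_funpow_flat_exp: "(deriv ^^ i) flat_exp = flat_exp_deriv i"
proof (induction i)
  case 0
  show ?case
    by (auto simp: flat_exp_def flat_exp_deriv_def deriv_numer_def)
next
  case (Suc i)
  then show ?case
    using DERIV_imp_deriv [OF flat_exp_deriv_has_derivative] by auto
qed

theorem theorem3:
  fixes i :: nat
  assumes "i \<ge> 1"
  shows "times_differentiable i flat_exp \<and>
    (\<forall>t::real. (deriv ^^ i) flat_exp t =
      (if t > 0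
       then 1 / (exp (1 / t) * t ^ (2 * i)) * (\<Sum>k = 0..i - 1. (- 1) ^ k * real (deriv_coeff i k) * t ^ k)
       else 0))"
proof (intro conjI allI)
  show "times_differentiable i flat_exp"
    unfolding times_differentiable_def deriv_funpow_flat_exp
    using flat_exp_deriv_has_derivative real_differentiable_def by blast
next
  fix t :: real
  have "exp (- 1 / t) = 1 / exp (1 / t)"
    by (simp add: exp_minus inverse_eq_divide)
  then show "(deriv ^^ i) flat_exp t =
      (if t > 0
       then 1 / (exp (1 / t) * t ^ (2 * i)) * (\<Sum>k = 0..i - 1. (- 1) ^ k * real (deriv_coeff i k) * t ^ k)
       else 0)"
    by (simp add: deriv_funpow_flat_exp flat_exp_deriv_def deriv_numer_altdef)
qed

end
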